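(* Let $\mathcal{S}^*$ be a set of interventional regimes, each of which is a control strategy, and let $o$ be the observational regime, with respect to the extended information base $(L_1,U_1,A_1,\ldots,L_n,U_n,A_n,L_{n+1})$. Suppose that (extended stability) for every $s\in\mathcal{S}^*$, with $\sigma$ the non-random regime indicator taking values in $\{o,s\}$, $$(L_i,U_i)\perp\!\!\!\perp \sigma \mid (\overline{L}_{i-1},\overline{U}_{i-1},\overline{A}_{i-1})\qquad (i=1,\ldots,n+1),$$ and (sequential randomization) with $\sigma$ taking values in $\{o\}\cup\mathcal{S}^*$, $$A_i\perp\!\!\!\perp \overline{U}_i\mid(\overline{L}_i,\overline{A}_{i-1};\sigma)\qquad(i=1,\ldots,n).$$ Then simple stability holds: for every $s\in\mathcal{S}^*$, with $\sigma$ taking values in $\{o,s\}$, $$L_i\perp\!\!\!\perp\sigma\mid(\overline{L}_{i-1},\overline{A}_{i-1})\qquad(i=1,\ldots,n+1).$$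
   Context: Setting. $L_1,U_1,A_1,\ldots,L_n,U_n,A_n,L_{n+1}\equiv Y$ are random variables (each $L_i$ or $U_i$ may be a finite collection of random variables) on a common measurable space $(\Omega,\mathcal{A})$. The $L_i$ are observable variables, the $A_i$ are action variables, the $U_i$ are unobserved variables, and $Y$ is the outcome. Write $\overline{L}_i=(L_1,\ldots,L_i)$, and similarly $\overline{U}_i,\overline{A}_i$; $\overline{L}_0,\overline{U}_0,\overline{A}_0$ are empty, and $U_{n+1}$ is empty. Regimes. There is a set of regimes $\{o\}\cup\mathcal{S}^*$; each regime $r$ has an associated probability measure $P_r$ on $(\Omega,\mathcal{A})$; $\mathbb{E}\{\cdot\mid\cdot\,;r\}$ denotes conditional expectation under $P_r$. The regime $o$ is the observational regime. The regime indicator $\sigma$ is a non-stochastic variable (a parameter) labelling the regimes in a specified set. Control strategy. A regime $s$ is a control strategy if $A_i\perp\!\!\!\perp\overline{U}_i\mid(\overline{L}_i,\overline{A}_{i-1};s)$ for $i=1,\ldots,n$ (ordinary conditional independence under $P_s$), and in addition the conditional distribution of $A_i$ given $(\overline{L}_i,\overline{A}_{i-1})$ under $P_s$ is known (regarded as given). Extended conditional independence. Let $X,Y,Z$ be random variables and let $\sigma$ take values in a set $\mathcal{R}$ of regimes. (a) $X\perp\!\!\!\perp Y\mid(Z;\sigma)$ means: for every bounded real measurable function $h$ there is a function $w(\sigma,Z)$, measurable in $Z$, such that for all $r\in\mathcal{R}$, $\mathbb{E}\{h(X)\mid Y,Z;r\}=w(r,Z)$ $P_r$-almost surely. (b) $X\perp\!\!\!\perp\sigma\mid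 Z$ means: for every bounded real measurable function $h$ there is a measurable function $w(Z)$, not depending on the regime, such that for all $r\in\mathcal{R}$, $\mathbb{E}\{h(X)\mid Z;r\}=w(Z)$ $P_r$-almost surely. *)

theory Defs
  imports "HOL-Probability.Probability"
begin

text \<open>
  A random variable is given by a function \<open>X\<close> on the sample space together with the
  measurable space \<open>MX\<close> in which it takes its values.  In a sequence \<open>X\<^sub>1, X\<^sub>2, \<dots>\<close> each \<open>X i\<close> has its
  own value space \<open>MX i\<close>, so an entry may itself be a finite collection of random variables.
  The indexed family \<open>{X j | j \<in> J}\<close> is regarded as one random variable with values in
  \<open>PiM J MX\<close>; for \<open>J = {}\<close> this is a one-point space, i.e. the family is empty.
  In particular \<open>family U ({i} \<inter> {1..n})\<close> is \<open>U i\<close> for \<open>i \<in> {1..n}\<close> and is empty for \<open>i = n + 1\<close>.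
\<close>

definition family :: "(nat \<Rightarrow> 'w \<Rightarrow> 'x) \<Rightarrow> nat set \<Rightarrow> 'w \<Rightarrow> (nat \<Rightarrow> 'x)" where
  "family X J \<omega> = (\<lambda>j\<in>J. X j \<omega>)"

abbreviation pair_rv :: "('w \<Rightarrow> 'x) \<Rightarrow> ('w \<Rightarrow> 'y) \<Rightarrow> 'w \<Rightarrow> 'x \<times> 'y"  (infixr "\<otimes>\<^sub>v" 80) where
  "X \<otimes>\<^sub>v Y \<equiv> \<lambda>\<omega>. (X \<omega>, Y \<omega>)"

definition cond_exp_rv ::
  "'w measure \<Rightarrow> 'z measure \<Rightarrow> ('w \<Rightarrow> 'z) \<Rightarrow> ('w \<Rightarrow> real) \<Rightarrow> 'w \<Rightarrow> real" where
  "cond_exp_rv P MZ Z f = real_cond_exp P (vimage_algebra (space P) Z MZ) f"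

definition bounded_measurable :: "'x measure \<Rightarrow> ('x \<Rightarrow> real) \<Rightarrow> bool" where
  "bounded_measurable MX h \<longleftrightarrow> h \<in> borel_measurable MX \<and> bounded (h ` space MX)"

text \<open>Ordinary conditional independence of \<open>X\<close> and \<open>Y\<close> given \<open>Z\<close> under a single probability \<open>P\<close>.\<close>

definition cond_indep ::
  "'w measure \<Rightarrow> 'x measure \<Rightarrow> ('w \<Rightarrow> 'x) \<Rightarrow> 'y measure \<Rightarrow> ('w \<Rightarrow> 'y)
    \<Rightarrow> 'z measure \<Rightarrow> ('w \<Rightarrow> 'z) \<Rightarrow> bool" where
  "cond_indep P MX X MY Y MZ Z \<longleftrightarrow>
    (\<forall>B\<in>sets MX. \<forall>C\<in>sets MY. AE \<omega> in P.
       cond_exp_rv P MZ Z (\<lambda>\<omega>'. indicator B (X \<omega>') * indicator C (Y \<omega>')) \<omega> =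
       cond_exp_rv P MZ Z (\<lambda>\<omega>'. indicator B (X \<omega>')) \<omega> *
       cond_exp_rv P MZ Z (\<lambda>\<omega>'. indicator C (Y \<omega>')) \<omega>)"

text \<open>
  Extended conditional independence, with the regime indicator \<open>\<sigma>\<close> ranging over the set \<open>R\<close> and
  \<open>P r\<close> the probability measure of regime \<open>r\<close>:
  \<open>eci R P MX X MY Y MZ Z\<close> is \<open>X \<bottom> Y | (Z; \<sigma>)\<close>, and
  \<open>eci_regime R P MX X MZ Z\<close> is \<open>X \<bottom> \<sigma> | Z\<close>.
\<close>

definition eci ::
  "'r set \<Rightarrow> ('r \<Rightarrow> 'w measure) \<Rightarrow> 'x measure \<Rightarrow> ('w \<Rightarrow> 'x) \<Rightarrow> 'y measure \<Rightarrow> ('w \<Rightarrow> 'y)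
    \<Rightarrow> 'z measure \<Rightarrow> ('w \<Rightarrow> 'z) \<Rightarrow> bool" where
  "eci R P MX X MY Y MZ Z \<longleftrightarrow>
    (\<forall>h. bounded_measurable MX h \<longrightarrow>
      (\<exists>w :: 'r \<Rightarrow> 'z \<Rightarrow> real.
        (\<forall>r\<in>R. w r \<in> borel_measurable MZ) \<and>
        (\<forall>r\<in>R. AE \<omega> in P r.
          cond_exp_rv (P r) (MY \<Otimes>\<^sub>M MZ) (Y \<otimes>\<^sub>v Z) (\<lambda>\<omega>'. h (X \<omega>')) \<omega> = w r (Z \<omega>))))"

definition eci_regime ::
  "'r set \<Rightarrow> ('r \<Rightarrow> 'w measure) \<Rightarrow> 'x measure \<Rightarrow> ('w \<Rightarrow> 'x) \<Rightarrow> 'z measure \<Rightarrow> ('w \<Rightarrow> 'z) \<Rightarrow> bool"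
  where
  "eci_regime R P MX X MZ Z \<longleftrightarrow>
    (\<forall>h. bounded_measurable MX h \<longrightarrow>
      (\<exists>w :: 'z \<Rightarrow> real.
        w \<in> borel_measurable MZ \<and>
        (\<forall>r\<in>R. AE \<omega> in P r.
          cond_exp_rv (P r) MZ Z (\<lambda>\<omega>'. h (X \<omega>')) \<omega> = w (Z \<omega>))))"

definition has_cond_distr ::
  "'w measure \<Rightarrow> 'x measure \<Rightarrow> ('w \<Rightarrow> 'x) \<Rightarrow> 'z measure \<Rightarrow> ('w \<Rightarrow> 'z) \<Rightarrow> ('z \<Rightarrow> 'x measure) \<Rightarrow> bool"
  where
  "has_cond_distr P MX X MZ Z \<kappa> \<longleftrightarrow>
    \<kappa> \<in> MZ \<rightarrow>\<^sub>M prob_algebra MX \<and>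
    (\<forall>B\<in>sets MX. AE \<omega> in P.
      cond_exp_rv P MZ Z (\<lambda>\<omega>'. indicator B (X \<omega>')) \<omega> = measure (\<kappa> (Z \<omega>)) B)"

text \<open>
  \<open>P\<close> is the probability measure of one regime.  That the conditional distribution of each action
  is known is rendered by a prescribed kernel \<open>\<kappa> i\<close>, part of the data of the strategy, which is
  the conditional distribution of \<open>A i\<close> given the observable past.
\<close>

definition control_strategy ::
  "nat \<Rightarrow> (nat \<Rightarrow> 'l measure) \<Rightarrow> (nat \<Rightarrow> 'w \<Rightarrow> 'l) \<Rightarrow> (nat \<Rightarrow> 'u measure) \<Rightarrow> (nat \<Rightarrow> 'w \<Rightarrow> 'u)
    \<Rightarrow> (nat \<Rightarrow> 'a measure) \<Rightarrow> (nat \<Rightarrow> 'w \<Rightarrow> 'a) \<Rightarrow> 'w measure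
    \<Rightarrow> (nat \<Rightarrow> (nat \<Rightarrow> 'l) \<times> (nat \<Rightarrow> 'a) \<Rightarrow> 'a measure) \<Rightarrow> bool" where
  "control_strategy n EL L EU U EA A P \<kappa> \<longleftrightarrow>
    (\<forall>i\<in>{1..n}.
      cond_indep P (EA i) (A i) (PiM {1..i} EU) (family U {1..i})
        (PiM {1..i} EL \<Otimes>\<^sub>M PiM {1..<i} EA) (family L {1..i} \<otimes>\<^sub>v family A {1..<i}) \<and>
      has_cond_distr P (EA i) (A i)
        (PiM {1..i} EL \<Otimes>\<^sub>M PiM {1..<i} EA) (family L {1..i} \<otimes>\<^sub>v family A {1..<i}) (\<kappa> i))"

end

theory Submission
  imports Defs
begin

text \<open>
  Under two regimes, the statement \<open>X \<bottom> \<sigma> | Z\<close> says that \<open>Z\<close> is a sufficient statistic, in the sense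
  of Halmos and Savage, for the regime indicator on the information carried by \<open>(X, Z)\<close>: relative
  to the sum of the regime measures, each of these has on the \<open>\<sigma>\<close>-algebra of \<open>(X, Z)\<close> a density
  that is measurable with respect to \<open>Z\<close>.  In this form the facts about conditional independence
  that one would otherwise have to prove for random variables become facts about nested
  \<open>\<sigma>\<close>-algebras: sufficiency is transitive (\<open>sufficient_trans\<close>), and it is trivially inherited when the
  large \<open>\<sigma>\<close>-algebra shrinks or the small one grows (\<open>sufficient_mono\<close>).  Moving a variable from the left
  of the bar to the right is of the latter kind: the densities stay what they are.

  Let \<open>S\<^sub>i\<close> be generated by the full past \<open>L\<^sub>j, U\<^sub>j, A\<^sub>j\<close> with \<open>j < i\<close>, and \<open>O\<^sub>i\<close> by the observable
  past \<open>L\<^sub>j, A\<^sub>j\<close> with \<open>j < i\<close>.  The invariant is that \<open>O\<^sub>i\<close> is sufficient for \<open>S\<^sub>i\<close>; it means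
  that the unobserved past is distributed in the same way in both regimes given the observable past.
  Extended stability makes \<open>S\<^sub>i\<close> sufficient for the \<open>\<sigma>\<close>-algebra generated by \<open>S\<^sub>i\<close>, \<open>L\<^sub>i\<close> and
  \<open>U\<^sub>i\<close>, so by transitivity \<open>O\<^sub>i\<close> is sufficient for it too; restricted to \<open>L\<^sub>i\<close> and \<open>O\<^sub>i\<close> this is simple
  stability at stage \<open>i\<close>.  To reach stage \<open>i + 1\<close>, first \<open>L\<^sub>i\<close> joins the small \<open>\<sigma>\<close>-algebra, which is
  monotonicity.  Then \<open>A\<^sub>i\<close> joins both \<open>\<sigma>\<close>-algebras, and this is where sequential randomization
  enters: within each regime \<open>A\<^sub>i\<close> says nothing about the unobserved past beyond what is observed, so
  conditioning on \<open>A\<^sub>i\<close> leaves the common conditional probabilities of that past unchanged, even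
  though the law of \<open>A\<^sub>i\<close> itself differs between the regimes (\<open>sufficient_join_cond_indep\<close>).
\<close>

section \<open>Joins of sigma-algebras\<close>

lemma sigma_sets_Un_sigma_sets:
  "sigma_sets \<Omega> (sigma_sets \<Omega> a \<union> sigma_sets \<Omega> b) = sigma_sets \<Omega> (a \<union> b)"
proof (rule sigma_sets_eqI)
  show "x \<in> sigma_sets \<Omega> (a \<union> b)" if "x \<in> sigma_sets \<Omega> a \<union> sigma_sets \<Omega> b" for x
    using that sigma_sets_subseteq[of a "a \<union> b" \<Omega>] sigma_sets_subseteq[of b "a \<union> b" \<Omega>] by blast
qed auto

text \<open>
  A sub-\<open>\<sigma>\<close>-algebra is represented, as in \<open>subalgebra\<close>, by a measure of which only the space and the
  system of sets matter; as a measure the join is zero.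
\<close>

definition join :: "'w measure \<Rightarrow> 'w measure \<Rightarrow> 'w measure" (infixl "\<squnion>\<^sub>\<sigma>" 65) where
  "F \<squnion>\<^sub>\<sigma> G = sigma (space F) (sets F \<union> sets G)"

lemma space_join [simp]: "space (F \<squnion>\<^sub>\<sigma> G) = space F"
  unfolding join_def by (simp add: space_measure_of_conv)

lemma sets_join:
  assumes "space G = space F"
  shows "sets (F \<squnion>\<^sub>\<sigma> G) = sigma_sets (space F) (sets F \<union> sets G)"
  unfolding join_def using assms sets.space_closed[of F] sets.space_closed[of G]
  by (intro sets_measure_of) auto

lemma sets_join_Int:
  assumes "space G = space F"
  shows "sets (F \<squnion>\<^sub>\<sigma> G) = sigma_sets (space F) {C \<inter> D | C D. C \<in> sets F \<and> D \<in> sets G}"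
  unfolding sets_join[OF assms]
proof (rule sigma_sets_eqI)
  fix a assume "a \<in> sets F \<union> sets G"
  moreover have "a = a \<inter> space F" if "a \<in> sets F" using sets.sets_into_space[OF that] by auto
  moreover have "a = space F \<inter> a" if "a \<in> sets G" using sets.sets_into_space[OF that] assms by auto
  moreover have "space F \<in> sets F" "space F \<in> sets G" using assms sets.top[of G] by auto
  ultimately show "a \<in> sigma_sets (space F) {C \<inter> D | C D. C \<in> sets F \<and> D \<in> sets G}"
    by (intro sigma_sets.Basic) blast
next
  interpret sigma_algebra "space F" "sigma_sets (space F) (sets F \<union> sets G)"
    using assms sets.space_closed[of F] sets.space_closed[of G]
    by (intro sigma_algebra_sigma_sets) auto
  fix b assume "b \<in> {C \<inter> D | C D. C \<in> sets F \<and> D \<in> sets G}"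
  then show "b \<in> sigma_sets (space F) (sets F \<union> sets G)" by auto
qed

lemma subalgebra_join:
  assumes "subalgebra M F" "subalgebra M G"
  shows "subalgebra M (F \<squnion>\<^sub>\<sigma> G)"
proof -
  have "sigma_sets (space M) (sets F \<union> sets G) \<subseteq> sets M"
    using assms unfolding subalgebra_def by (intro sets.sigma_sets_subset) auto
  then show ?thesis using assms sets_join[of G F] unfolding subalgebra_def by simp
qed

lemma subalgebra_join_left: "space G = space F \<Longrightarrow> subalgebra (F \<squnion>\<^sub>\<sigma> G) F"
  unfolding subalgebra_def by (auto simp: sets_join)

lemma subalgebra_join_right: "space G = space F \<Longrightarrow> subalgebra (F \<squnion>\<^sub>\<sigma> G) G"
  unfolding subalgebra_def by (auto simp: sets_join)

lemma join_cong:
  assumes "sets F = sets F'" "sets G = sets G'"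
  shows "F \<squnion>\<^sub>\<sigma> G = F' \<squnion>\<^sub>\<sigma> G'"
  using assms sets_eq_imp_space_eq[OF assms(1)] by (simp add: join_def)

text \<open>
  The intersections \<open>C \<inter> D\<close> form a generator of the join that is closed under intersection, so the
  uniqueness theorem for finite measures applies.
\<close>

lemma measure_eq_on_join:
  assumes sub: "subalgebra M F" "subalgebra M G"
    and sets: "sets N = sets M" "sets N' = sets M"
    and fin: "emeasure N (space M) \<noteq> \<infinity>"
    and eq: "\<And>C D. C \<in> sets F \<Longrightarrow> D \<in> sets G \<Longrightarrow> emeasure N (C \<inter> D) = emeasure N' (C \<inter> D)"
    and B: "B \<in> sets (F \<squnion>\<^sub>\<sigma> G)"
  shows "emeasure N B = emeasure N' B"
proof -
  let ?H = "F \<squnion>\<^sub>\<sigma> G" and ?E = "{C \<inter> D | C D. C \<in> sets F \<and> D \<in> sets G}"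
  have sp: "space F = space M" "space G = space M" using sub by (auto simp: subalgebra_def)
  have spN: "space N = space M" "space N' = space M" using sets by (auto dest: sets_eq_imp_space_eq)
  have sN: "subalgebra N ?H" "subalgebra N' ?H"
    using subalgebra_join[OF sub] sets spN by (auto simp: subalgebra_def)
  have E: "?E \<subseteq> sets ?H" using sp by (subst sets_join_Int) auto
  have H: "sets ?H = sigma_sets (space M) ?E" using sp by (subst sets_join_Int) auto
  have "restr_to_subalg N ?H = restr_to_subalg N' ?H"
  proof (rule measure_eqI_generator_eq[where E = ?E and \<Omega> = "space M" and A = "\<lambda>_. space M"])
    show "Int_stable ?E"
    proof (rule Int_stableI)
      fix a b assume "a \<in> ?E" "b \<in> ?E"
      then obtain C D C' D' where "a = C \<inter> D" "b = C' \<inter> D'" "C \<in> sets F" "D \<in> sets G"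
        "C' \<in> sets F" "D' \<in> sets G" by auto
      then have "a \<inter> b = (C \<inter> C') \<inter> (D \<inter> D')" "C \<inter> C' \<in> sets F" "D \<inter> D' \<in> sets G" by auto
      then show "a \<inter> b \<in> ?E" by blast
    qed
    show "?E \<subseteq> Pow (space M)" using sp sets.sets_into_space[of _ F] by auto
    show "emeasure (restr_to_subalg N ?H) X = emeasure (restr_to_subalg N' ?H) X" if "X \<in> ?E" for X
      using that E eq by (auto simp: emeasure_restr_to_subalg[OF sN(1)] emeasure_restr_to_subalg[OF sN(2)] subset_iff)
    show "sets (restr_to_subalg N ?H) = sigma_sets (space M) ?E"
      "sets (restr_to_subalg N' ?H) = sigma_sets (space M) ?E"
      using H by (auto simp: sets_restr_to_subalg[OF sN(1)] sets_restr_to_subalg[OF sN(2)])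
    have "space M = space M \<inter> space M" by simp
    then show "range (\<lambda>_. space M) \<subseteq> ?E" using sp sets.top[of F] sets.top[of G] by auto
    have "space M \<in> sets ?H" using sets.top[of ?H] sp by simp
    then show "emeasure (restr_to_subalg N ?H) (space M) \<noteq> \<infinity>"
      using fin by (simp add: emeasure_restr_to_subalg[OF sN(1)])
  qed simp
  then show ?thesis
    using emeasure_restr_to_subalg[OF sN(1) B] emeasure_restr_to_subalg[OF sN(2) B] by simp
qed

section \<open>Conditional expectations under one measure\<close>

text \<open>
  Symmetry of conditional independence within one regime.  The hypothesis \<open>ci\<close> says that events of
  \<open>A\<close> have the same conditional probability given \<open>F\<close> as given \<open>G\<close>; the conclusion is that events of
  \<open>F\<close> keep their conditional probability given \<open>G\<close> when \<open>A\<close> is added to the condition.  On a set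
  \<open>B \<inter> D\<close> with \<open>B\<close> from \<open>G\<close> and \<open>D\<close> from \<open>A\<close> both sides are the integral over \<open>B\<close> of the product
  of the conditional probabilities of \<open>C\<close> and \<open>D\<close> given \<open>G\<close>.
\<close>

lemma cond_indep_symmetric:
  assumes fin: "finite_measure P" and F: "subalgebra P F" and G: "subalgebra F G" and A: "subalgebra P A"
    and ci: "\<And>D. D \<in> sets A \<Longrightarrow> \<exists>\<alpha>\<in>borel_measurable G. \<forall>C\<in>sets F. emeasure P (D \<inter> C) = (\<integral>\<^sup>+\<omega>\<in>C. \<alpha> \<omega> \<partial>P)"
    and C: "C \<in> sets F" and B: "B \<in> sets (G \<squnion>\<^sub>\<sigma> A)"
  shows "emeasure P (C \<inter> B) = (\<integral>\<^sup>+\<omega>\<in>B. nn_cond_exp P G (indicator C) \<omega> \<partial>P)"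
proof -
  interpret finite_measure P by fact
  have PG: "subalgebra P G" using F G by (auto simp: subalgebra_def)
  interpret finite_measure_subalgebra P G by unfold_locales (fact PG)
  have FP: "sets F \<subseteq> sets P" and GF: "sets G \<subseteq> sets F" and AP: "sets A \<subseteq> sets P"
    using F G A by (auto simp: subalgebra_def)
  have C'[measurable]: "C \<in> sets P" using C FP by auto
  define w where "w = nn_cond_exp P G (indicator C)"
  have w[measurable]: "w \<in> borel_measurable G" "w \<in> borel_measurable P" by (auto simp: w_def)
  have "emeasure (density P (indicator C)) B = emeasure (density P w) B"
  proof (rule measure_eq_on_join[OF PG A _ _ _ _ B])
    show "emeasure (density P (indicator C)) (space P) \<noteq> \<infinity>"
      by (simp add: emeasure_density emeasure_finite)
  next
    fix B0 D assume B0[measurable]: "B0 \<in> sets G" and D: "D \<in> sets A"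
    have D'[measurable]: "D \<in> sets P" using D AP by auto
    have B0_F: "B0 \<in> sets F" using B0 GF by blast
    then have B0'[measurable]: "B0 \<in> sets P" using FP by blast
    obtain \<alpha> where \<alpha>[measurable]: "\<alpha> \<in> borel_measurable G"
      and ci': "\<And>C. C \<in> sets F \<Longrightarrow> emeasure P (D \<inter> C) = (\<integral>\<^sup>+\<omega>\<in>C. \<alpha> \<omega> \<partial>P)"
      using ci[OF D] by auto
    have \<alpha>'[measurable]: "\<alpha> \<in> borel_measurable P" using measurable_from_subalg[OF PG \<alpha>] .
    have *: "AE x in P. \<alpha> x = nn_cond_exp P G (indicator D) x"
    proof (rule nn_cond_exp_charact)
      fix B assume B: "B \<in> sets G"
      then have [measurable]: "B \<in> sets P" using FP GF by auto
      show "(\<integral>\<^sup>+ x\<in>B. indicator D x \<partial>P) = (\<integral>\<^sup>+ x\<in>B. \<alpha> x \<partial>P)"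
        using ci'[of B] B GF by (auto simp: indicator_inter_arith[symmetric] nn_integral_indicator)
    qed auto
    have "emeasure (density P (indicator C)) (B0 \<inter> D) = emeasure P (D \<inter> (C \<inter> B0))"
      by (simp add: emeasure_density indicator_inter_arith[symmetric] Int_ac)
    also have "\<dots> = (\<integral>\<^sup>+\<omega>\<in>C \<inter> B0. \<alpha> \<omega> \<partial>P)"
      using C B0_F by (intro ci') auto
    also have "\<dots> = (\<integral>\<^sup>+\<omega>. (\<alpha> \<omega> * indicator B0 \<omega>) * indicator C \<omega> \<partial>P)"
      by (intro nn_integral_cong) (auto simp: indicator_def)
    also have "\<dots> = (\<integral>\<^sup>+\<omega>. (\<alpha> \<omega> * indicator B0 \<omega>) * w \<omega> \<partial>P)"
      unfolding w_def by (rule nn_cond_exp_intg[symmetric]) auto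
    also have "\<dots> = (\<integral>\<^sup>+\<omega>. (w \<omega> * indicator B0 \<omega>) * nn_cond_exp P G (indicator D) \<omega> \<partial>P)"
      using * by (intro nn_integral_cong_AE) (auto simp: mult_ac)
    also have "\<dots> = (\<integral>\<^sup>+\<omega>. (w \<omega> * indicator B0 \<omega>) * indicator D \<omega> \<partial>P)"
      by (rule nn_cond_exp_intg) auto
    also have "\<dots> = emeasure (density P w) (B0 \<inter> D)"
      by (simp add: emeasure_density indicator_inter_arith mult.assoc)
    finally show "emeasure (density P (indicator C)) (B0 \<inter> D) = emeasure (density P w) (B0 \<inter> D)" .
  qed auto
  moreover have [measurable]: "B \<in> sets P"
    using subalgebra_join[OF PG A] B by (auto simp: subalgebra_def)
  ultimately show ?thesis
    unfolding w_def by (simp add: emeasure_density indicator_inter_arith[symmetric])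
qed

text \<open>
  A density that is valid only on the events of \<open>F\<close> still transforms integrals of \<open>F\<close>-measurable
  functions, because both integrals can be computed on the restrictions to \<open>F\<close>.
\<close>

lemma nn_integral_density_on_subalgebra:
  assumes M: "subalgebra M F" and N: "subalgebra N F"
    and f[measurable]: "f \<in> borel_measurable F"
    and eq: "\<And>C. C \<in> sets F \<Longrightarrow> emeasure N C = (\<integral>\<^sup>+x\<in>C. f x \<partial>M)"
    and h[measurable]: "h \<in> borel_measurable F"
  shows "(\<integral>\<^sup>+x. h x \<partial>N) = (\<integral>\<^sup>+x. f x * h x \<partial>M)"
proof -
  note [measurable_cong] = sets_restr_to_subalg[OF M] sets_restr_to_subalg[OF N]
  have "restr_to_subalg N F = density (restr_to_subalg M F) f"
  proof (rule measure_eqI)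
    fix C assume "C \<in> sets (restr_to_subalg N F)"
    then have C[measurable]: "C \<in> sets F" by (simp add: sets_restr_to_subalg[OF N])
    then show "emeasure (restr_to_subalg N F) C = emeasure (density (restr_to_subalg M F) f) C"
      by (simp add: emeasure_restr_to_subalg[OF N] eq emeasure_density nn_integral_subalgebra2[OF M])
  qed (simp add: sets_restr_to_subalg[OF M] sets_restr_to_subalg[OF N])
  then have "(\<integral>\<^sup>+x. h x \<partial>N) = (\<integral>\<^sup>+x. h x \<partial>density (restr_to_subalg M F) f)"
    by (simp add: nn_integral_subalgebra2[OF N, symmetric])
  also have "\<dots> = (\<integral>\<^sup>+x. f x * h x \<partial>M)"
    by (simp add: nn_integral_density nn_integral_subalgebra2[OF M])
  finally show ?thesis .
qed

lemma (in sigma_finite_subalgebra) nn_cond_exp_eq_real_cond_exp: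
  assumes f: "integrable M f" and nonneg: "\<And>x. 0 \<le> f x"
  shows "AE x in M. ennreal (real_cond_exp M F f x) = nn_cond_exp M F (\<lambda>x. ennreal (f x)) x"
proof (rule nn_cond_exp_charact)
  have f'[measurable]: "f \<in> borel_measurable M" using f by auto
  show "(\<lambda>x. ennreal (f x)) \<in> borel_measurable M" by measurable
  show "(\<lambda>x. ennreal (real_cond_exp M F f x)) \<in> borel_measurable F" by measurable
  have pos: "AE x in M. 0 \<le> real_cond_exp M F f x" using nonneg by (intro real_cond_exp_pos) auto
  fix A assume A: "A \<in> sets F"
  then have A'[measurable]: "A \<in> sets M" using subalg by (auto simp: subalgebra_def)
  have int: "integrable M (\<lambda>x. indicator A x * f x)" "integrable M (\<lambda>x. indicator A x * real_cond_exp M F f x)"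
    using integrable_mult_indicator[OF A' f] integrable_mult_indicator[OF A' real_cond_exp_int(1)[OF f]] by auto
  have "(\<integral>\<^sup>+ x\<in>A. ennreal (f x) \<partial>M) = (\<integral>\<^sup>+ x. ennreal (indicator A x * f x) \<partial>M)"
    by (intro nn_integral_cong) (auto simp: indicator_def)
  also have "\<dots> = ennreal (\<integral>x. indicator A x * f x \<partial>M)"
    using int nonneg by (intro nn_integral_eq_integral) auto
  also have "(\<integral>x. indicator A x * f x \<partial>M) = (\<integral>x. indicator A x * real_cond_exp M F f x \<partial>M)"
    using real_cond_exp_intA[OF f A] by (simp add: set_lebesgue_integral_def)
  also have "ennreal \<dots> = (\<integral>\<^sup>+ x. ennreal (indicator A x * real_cond_exp M F f x) \<partial>M)"
    using int pos by (intro nn_integral_eq_integral[symmetric]) auto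
  also have "\<dots> = (\<integral>\<^sup>+ x\<in>A. ennreal (real_cond_exp M F f x) \<partial>M)"
    by (intro nn_integral_cong) (auto simp: indicator_def)
  finally show "(\<integral>\<^sup>+ x\<in>A. ennreal (f x) \<partial>M) = (\<integral>\<^sup>+ x\<in>A. ennreal (real_cond_exp M F f x) \<partial>M)" .
qed

text \<open>
  Conditional expectations of random variables are real-valued, whereas the arguments below use
  extended nonnegative integrals, for which no integrability has to be checked.  This is the passage
  from the former to the latter for the conditional probability of an event.
\<close>

lemma emeasure_Int_eq_cond_exp:
  assumes fin: "finite_measure P" and G: "subalgebra P G"
    and X[measurable]: "X \<in> P \<rightarrow>\<^sub>M MX" and B[measurable]: "B \<in> sets MX"
    and v: "AE \<omega> in P. real_cond_exp P G (\<lambda>\<omega>'. indicator B (X \<omega>')) \<omega> = v \<omega>"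
    and D: "D \<in> sets G"
  shows "emeasure P ((X -` B \<inter> space P) \<inter> D) = (\<integral>\<^sup>+\<omega>\<in>D. ennreal (v \<omega>) \<partial>P)"
proof -
  interpret finite_measure P by fact
  interpret finite_measure_subalgebra P G by unfold_locales (fact G)
  let ?f = "\<lambda>\<omega>. indicator B (X \<omega>) :: real"
  have D'[measurable]: "D \<in> sets P" using D G by (auto simp: subalgebra_def)
  have "integrable P ?f" by (rule integrable_const_bound[of _ 1]) auto
  then have *: "AE \<omega> in P. nn_cond_exp P G (\<lambda>\<omega>. ennreal (?f \<omega>)) \<omega> = ennreal (v \<omega>)"
    using nn_cond_exp_eq_real_cond_exp[of ?f] v by (auto elim: AE_mp)
  have "emeasure P ((X -` B \<inter> space P) \<inter> D) = (\<integral>\<^sup>+\<omega>. indicator ((X -` B \<inter> space P) \<inter> D) \<omega> \<partial>P)"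
    by simp
  also have "\<dots> = (\<integral>\<^sup>+\<omega>. indicator D \<omega> * ennreal (?f \<omega>) \<partial>P)"
    by (intro nn_integral_cong) (auto simp: indicator_def)
  also have "\<dots> = (\<integral>\<^sup>+\<omega>. indicator D \<omega> * nn_cond_exp P G (\<lambda>\<omega>. ennreal (?f \<omega>)) \<omega> \<partial>P)"
    using D by (intro nn_cond_exp_intg[symmetric]) auto
  also have "\<dots> = (\<integral>\<^sup>+\<omega>\<in>D. ennreal (v \<omega>) \<partial>P)"
    using * by (intro nn_integral_cong_AE) (auto simp: mult.commute)
  finally show ?thesis .
qed

section \<open>Sufficient sigma-algebras for a finite set of regimes\<close>

locale regimes =
  fixes M :: "'w measure" and R :: "'r set" and P :: "'r \<Rightarrow> 'w measure"
  assumes finite_R: "finite R" and R_nonempty: "R \<noteq> {}"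
    and prob: "\<And>r. r \<in> R \<Longrightarrow> prob_space (P r)"
    and sets_P: "\<And>r. r \<in> R \<Longrightarrow> sets (P r) = sets M"
begin

text \<open>
  The sum of the regime measures, a finite measure dominating each of them: binding the counting
  measure of \<open>R\<close> to \<open>P\<close> adds up the members of the family.
\<close>

definition pooled :: "'w measure" where
  "pooled = count_space R \<bind> P"

text \<open>
  The factorization criterion: on \<open>F\<close> the likelihood of every regime relative to the pooled measure
  can be computed from \<open>G\<close> alone.  Stating sufficiency through densities rather than through
  conditional expectations makes monotonicity in both arguments immediate and turns the extension
  from a generator of \<open>F\<close> to all of \<open>F\<close> into uniqueness of measures.
\<close>

definition sufficient :: "'w measure \<Rightarrow> 'w measure \<Rightarrow> bool" where
  "sufficient F G \<longleftrightarrow>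
    (\<forall>r\<in>R. \<exists>f\<in>borel_measurable G. \<forall>C\<in>sets F. emeasure (P r) C = (\<integral>\<^sup>+\<omega>\<in>C. f \<omega> \<partial>pooled))"

lemma space_P: "r \<in> R \<Longrightarrow> space (P r) = space M"
  using sets_P by (rule sets_eq_imp_space_eq)

lemma subalgebra_P: "r \<in> R \<Longrightarrow> subalgebra M F \<Longrightarrow> subalgebra (P r) F"
  using sets_P space_P by (auto simp: subalgebra_def)

lemma finite_measure_P: "r \<in> R \<Longrightarrow> finite_measure (P r)"
  using prob by (auto simp: prob_space_def)

lemma kernel_P: "P \<in> count_space R \<rightarrow>\<^sub>M subprob_algebra M"
  using prob sets_P by (auto simp: space_subprob_algebra intro: prob_space_imp_subprob_space)

lemma sets_pooled [simp, measurable_cong]: "sets pooled = sets M"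
  unfolding pooled_def using kernel_P R_nonempty by (intro sets_bind_measurable) auto

lemma space_pooled [simp]: "space pooled = space M"
  using sets_pooled by (rule sets_eq_imp_space_eq)

lemma subalgebra_pooled: "subalgebra M F \<Longrightarrow> subalgebra pooled F"
  by (auto simp: subalgebra_def)

lemma nn_integral_pooled:
  assumes "f \<in> borel_measurable M"
  shows "(\<integral>\<^sup>+\<omega>. f \<omega> \<partial>pooled) = (\<Sum>r\<in>R. \<integral>\<^sup>+\<omega>. f \<omega> \<partial>P r)"
  unfolding pooled_def nn_integral_bind[OF assms kernel_P]
  using finite_R by (simp add: nn_integral_count_space_finite)

lemma emeasure_pooled: "C \<in> sets M \<Longrightarrow> emeasure pooled C = (\<Sum>r\<in>R. emeasure (P r) C)"
  using nn_integral_pooled[of "indicator C"] sets_P by simp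

lemma finite_measure_pooled: "finite_measure pooled"
proof (rule finite_measureI)
  have "emeasure pooled (space M) = (\<Sum>r\<in>R. emeasure (P r) (space M))" by (simp add: emeasure_pooled)
  then show "emeasure pooled (space pooled) \<noteq> \<infinity>"
    using finite_measure.emeasure_finite[OF finite_measure_P] finite_R by auto
qed

lemma sufficientD:
  assumes "sufficient F G" "r \<in> R"
  obtains f where "f \<in> borel_measurable G" "\<And>C. C \<in> sets F \<Longrightarrow> emeasure (P r) C = (\<integral>\<^sup>+\<omega>\<in>C. f \<omega> \<partial>pooled)"
  using assms unfolding sufficient_def by blast

text \<open>
  The Radon-Nikodym theorem on \<open>G\<close>.
\<close>

lemma sufficient_refl:
  assumes G: "subalgebra M G"
  shows "sufficient G G"
  unfolding sufficient_def
proof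
  fix r assume r: "r \<in> R"
  note T = subalgebra_pooled[OF G] and S = subalgebra_P[OF r G]
  interpret finite_measure "restr_to_subalg pooled G"
    by (rule finite_measure_restr_to_subalg[OF T finite_measure_pooled])
  have "absolutely_continuous (restr_to_subalg pooled G) (restr_to_subalg (P r) G)"
    unfolding absolutely_continuous_def null_sets_restr_to_subalg[OF T] null_sets_restr_to_subalg[OF S]
    using r finite_R sets_P emeasure_pooled by (auto simp: null_sets_def)
  then obtain f where "f \<in> borel_measurable (restr_to_subalg pooled G)"
    and f: "density (restr_to_subalg pooled G) f = restr_to_subalg (P r) G"
    using Radon_Nikodym[of "restr_to_subalg (P r) G"] sets_restr_to_subalg[OF S] sets_restr_to_subalg[OF T] by auto
  then have f_G[measurable]: "f \<in> borel_measurable G" using measurable_in_subalg'[OF T] by auto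
  show "\<exists>f\<in>borel_measurable G. \<forall>C\<in>sets G. emeasure (P r) C = (\<integral>\<^sup>+\<omega>\<in>C. f \<omega> \<partial>pooled)"
  proof (intro bexI ballI)
    fix C assume C[measurable]: "C \<in> sets G"
    have "emeasure (P r) C = emeasure (density (restr_to_subalg pooled G) f) C"
      unfolding f using C by (rule emeasure_restr_to_subalg[OF S, symmetric])
    also have "\<dots> = (\<integral>\<^sup>+\<omega>\<in>C. f \<omega> \<partial>restr_to_subalg pooled G)"
      using measurable_in_subalg[OF T f_G] C sets_restr_to_subalg[OF T] by (intro emeasure_density) auto
    also have "\<dots> = (\<integral>\<^sup>+\<omega>\<in>C. f \<omega> \<partial>pooled)" by (rule nn_integral_subalgebra2[OF T]) measurable
    finally show "emeasure (P r) C = (\<integral>\<^sup>+\<omega>\<in>C. f \<omega> \<partial>pooled)" .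
  qed (fact f_G)
qed

text \<open>
  This contains both decomposition and weak union for the statement \<open>X \<bottom> \<sigma> | Z\<close>.
\<close>

lemma sufficient_mono:
  assumes "sufficient F G" "sets F' \<subseteq> sets F" "subalgebra G' G"
  shows "sufficient F' G'"
  using assms measurable_from_subalg[OF assms(3)] unfolding sufficient_def by (meson subsetD)

lemma nn_integral_P:
  assumes "r \<in> R" "subalgebra M F" "f \<in> borel_measurable F"
    and "\<And>C. C \<in> sets F \<Longrightarrow> emeasure (P r) C = (\<integral>\<^sup>+\<omega>\<in>C. f \<omega> \<partial>pooled)"
    and "h \<in> borel_measurable F"
  shows "(\<integral>\<^sup>+\<omega>. h \<omega> \<partial>P r) = (\<integral>\<^sup>+\<omega>. f \<omega> * h \<omega> \<partial>pooled)"
  using assms by (intro nn_integral_density_on_subalgebra[where F = F] subalgebra_P subalgebra_pooled)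

text \<open>
  Sufficiency yields conditional expectations that do not depend on the regime: the version for the
  pooled measure serves all of them, since the density of the regime can be pulled out of the
  conditional expectation.
\<close>

lemma sufficient_nn_cond_exp:
  assumes suff: "sufficient F G" and F: "subalgebra M F" and G: "subalgebra F G" and r: "r \<in> R"
    and g[measurable]: "g \<in> borel_measurable F"
  shows "AE \<omega> in P r. nn_cond_exp pooled G g \<omega> = nn_cond_exp (P r) G g \<omega>"
proof -
  have MG: "subalgebra M G" using F G by (auto simp: subalgebra_def)
  interpret T: finite_measure pooled by (rule finite_measure_pooled)
  interpret T: finite_measure_subalgebra pooled G by unfold_locales (rule subalgebra_pooled[OF MG])
  interpret Q: finite_measure "P r" by (rule finite_measure_P[OF r])
  interpret Q: finite_measure_subalgebra "P r" G by unfold_locales (rule subalgebra_P[OF r MG])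
  obtain f where f[measurable]: "f \<in> borel_measurable G"
    and dens: "\<And>C. C \<in> sets F \<Longrightarrow> emeasure (P r) C = (\<integral>\<^sup>+\<omega>\<in>C. f \<omega> \<partial>pooled)"
    using sufficientD[OF suff r] by blast
  have f_F[measurable]: "f \<in> borel_measurable F" using measurable_from_subalg[OF G f] .
  note change = nn_integral_P[OF r F f_F dens]
  show ?thesis
  proof (rule Q.nn_cond_exp_charact)
    show "g \<in> borel_measurable (P r)"
      using measurable_from_subalg[OF subalgebra_P[OF r F] g] .
    have g_T[measurable]: "g \<in> borel_measurable pooled"
      using measurable_from_subalg[OF subalgebra_pooled[OF F] g] .
    have w[measurable]: "nn_cond_exp pooled G g \<in> borel_measurable F"
      by (rule measurable_from_subalg[OF G]) measurable
    fix A assume A[measurable]: "A \<in> sets G"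
    have A_F[measurable]: "A \<in> sets F" using A G unfolding subalgebra_def by blast
    have "(\<integral>\<^sup>+\<omega>\<in>A. g \<omega> \<partial>P r) = (\<integral>\<^sup>+\<omega>. f \<omega> * (g \<omega> * indicator A \<omega>) \<partial>pooled)"
      by (intro change borel_measurable_times_ennreal borel_measurable_indicator g A_F)
    also have "\<dots> = (\<integral>\<^sup>+\<omega>. (f \<omega> * indicator A \<omega>) * g \<omega> \<partial>pooled)" by (simp add: mult_ac)
    also have "\<dots> = (\<integral>\<^sup>+\<omega>. (f \<omega> * indicator A \<omega>) * nn_cond_exp pooled G g \<omega> \<partial>pooled)"
      by (rule T.nn_cond_exp_intg[symmetric]) measurable
    also have "\<dots> = (\<integral>\<^sup>+\<omega>. f \<omega> * (nn_cond_exp pooled G g \<omega> * indicator A \<omega>) \<partial>pooled)"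
      by (simp add: mult_ac)
    also have "\<dots> = (\<integral>\<^sup>+\<omega>\<in>A. nn_cond_exp pooled G g \<omega> \<partial>P r)"
      by (intro change[symmetric] borel_measurable_times_ennreal borel_measurable_indicator w A_F)
    finally show "(\<integral>\<^sup>+\<omega>\<in>A. g \<omega> \<partial>P r) = (\<integral>\<^sup>+\<omega>\<in>A. nn_cond_exp pooled G g \<omega> \<partial>P r)" .
  qed measurable
qed

text \<open>
  Contraction: the density on \<open>F\<close> that is measurable for \<open>G\<close> and the density on \<open>G\<close> that is
  measurable for \<open>H\<close> agree almost everywhere, as both are densities on \<open>G\<close>.
\<close>

lemma sufficient_trans:
  assumes FG: "sufficient F G" and GH: "sufficient G H"
    and F: "subalgebra M F" and G: "subalgebra F G" and H: "subalgebra G H"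
  shows "sufficient F H"
  unfolding sufficient_def
proof
  fix r assume r: "r \<in> R"
  have TG: "subalgebra pooled G" using F G by (auto simp: subalgebra_def)
  interpret T: finite_measure "restr_to_subalg pooled G"
    by (rule finite_measure_restr_to_subalg[OF TG finite_measure_pooled])
  obtain g where g: "g \<in> borel_measurable G"
    and g': "\<And>C. C \<in> sets F \<Longrightarrow> emeasure (P r) C = (\<integral>\<^sup>+\<omega>\<in>C. g \<omega> \<partial>pooled)"
    using sufficientD[OF FG r] by blast
  obtain h where h: "h \<in> borel_measurable H"
    and h': "\<And>C. C \<in> sets G \<Longrightarrow> emeasure (P r) C = (\<integral>\<^sup>+\<omega>\<in>C. h \<omega> \<partial>pooled)"
    using sufficientD[OF GH r] by blast
  have h_G: "h \<in> borel_measurable G" using measurable_from_subalg[OF H h] .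
  have "AE \<omega> in restr_to_subalg pooled G. g \<omega> = h \<omega>"
  proof (rule T.density_unique_finite_measure)
    fix A assume "A \<in> sets (restr_to_subalg pooled G)"
    then have A[measurable]: "A \<in> sets G" by (simp add: sets_restr_to_subalg[OF TG])
    note [measurable] = g h_G
    have "A \<in> sets F" using A G unfolding subalgebra_def by blast
    then have "(\<integral>\<^sup>+\<omega>\<in>A. g \<omega> \<partial>pooled) = (\<integral>\<^sup>+\<omega>\<in>A. h \<omega> \<partial>pooled)" using g' h' A by metis
    then show "(\<integral>\<^sup>+\<omega>\<in>A. g \<omega> \<partial>restr_to_subalg pooled G) = (\<integral>\<^sup>+\<omega>\<in>A. h \<omega> \<partial>restr_to_subalg pooled G)"
      by (simp add: nn_integral_subalgebra2[OF TG])
  qed (use measurable_in_subalg[OF TG g] measurable_in_subalg[OF TG h_G] in auto)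
  then have "AE \<omega> in pooled. g \<omega> = h \<omega>" by (rule AE_restr_to_subalg[OF TG])
  then have "(\<integral>\<^sup>+\<omega>\<in>C. g \<omega> \<partial>pooled) = (\<integral>\<^sup>+\<omega>\<in>C. h \<omega> \<partial>pooled)" for C
    by (intro nn_integral_cong_AE) auto
  then show "\<exists>f\<in>borel_measurable H. \<forall>C\<in>sets F. emeasure (P r) C = (\<integral>\<^sup>+\<omega>\<in>C. f \<omega> \<partial>pooled)"
    using h g' by auto
qed

text \<open>
  Conversely, if the events of \<open>F\<close> have conditional probabilities given \<open>G\<close> that are common to all
  regimes, then these are also conditional probabilities under the pooled measure.  Hence the
  density \<open>f\<close> of a regime on \<open>G\<close> gives the right mass to every intersection \<open>C \<inter> D\<close> with \<open>C\<close> from \<open>F\<close>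
  and \<open>D\<close> from \<open>G\<close>, and therefore to every event of the join.
\<close>

lemma sufficient_joinI:
  assumes F: "subalgebra M F" and G: "subalgebra M G"
    and common: "\<And>C. C \<in> sets F \<Longrightarrow> \<exists>w\<in>borel_measurable G. \<forall>r\<in>R. \<forall>B\<in>sets G.
      emeasure (P r) (C \<inter> B) = (\<integral>\<^sup>+\<omega>\<in>B. w \<omega> \<partial>P r)"
  shows "sufficient (F \<squnion>\<^sub>\<sigma> G) G"
  unfolding sufficient_def
proof
  fix r assume r: "r \<in> R"
  interpret T: finite_measure pooled by (rule finite_measure_pooled)
  interpret T: finite_measure_subalgebra pooled G by unfold_locales (rule subalgebra_pooled[OF G])
  obtain f where f[measurable]: "f \<in> borel_measurable G"
    and dens: "\<And>C. C \<in> sets G \<Longrightarrow> emeasure (P r) C = (\<integral>\<^sup>+\<omega>\<in>C. f \<omega> \<partial>pooled)"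
    using sufficientD[OF sufficient_refl[OF G] r] by blast
  have f_M[measurable]: "f \<in> borel_measurable M" using measurable_from_subalg[OF G f] .
  have "emeasure (P r) B = emeasure (density pooled f) B" if "B \<in> sets (F \<squnion>\<^sub>\<sigma> G)" for B
  proof (rule measure_eq_on_join[OF F G _ _ _ _ that])
    show "emeasure (P r) (space M) \<noteq> \<infinity>"
      using finite_measure.emeasure_finite[OF finite_measure_P[OF r]] by simp
    fix C D assume C: "C \<in> sets F" and D[measurable]: "D \<in> sets G"
    have C_M[measurable]: "C \<in> sets M" using C F by (auto simp: subalgebra_def)
    have D_M[measurable]: "D \<in> sets M" using D G unfolding subalgebra_def by blast
    obtain w where w[measurable]: "w \<in> borel_measurable G"
      and w': "\<And>r B. r \<in> R \<Longrightarrow> B \<in> sets G \<Longrightarrow> emeasure (P r) (C \<inter> B) = (\<integral>\<^sup>+\<omega>\<in>B. w \<omega> \<partial>P r)"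
      using common[OF C] by blast
    have w_M[measurable]: "w \<in> borel_measurable M" using measurable_from_subalg[OF G w] .
    \<comment> \<open>Summing the equations for the single regimes identifies the common version under the pooled measure.\<close>
    have *: "AE \<omega> in pooled. w \<omega> = nn_cond_exp pooled G (indicator C) \<omega>"
    proof (rule T.nn_cond_exp_charact)
      fix B assume B: "B \<in> sets G"
      have B_M[measurable]: "B \<in> sets M" using B G unfolding subalgebra_def by blast
      have "(\<integral>\<^sup>+\<omega>\<in>B. indicator C \<omega> \<partial>pooled) = emeasure pooled (C \<inter> B)"
        by (simp add: indicator_inter_arith[symmetric])
      also have "\<dots> = (\<Sum>r\<in>R. \<integral>\<^sup>+\<omega>\<in>B. w \<omega> \<partial>P r)" by (simp add: emeasure_pooled w' B)
      also have "\<dots> = (\<integral>\<^sup>+\<omega>\<in>B. w \<omega> \<partial>pooled)" by (simp add: nn_integral_pooled)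
      finally show "(\<integral>\<^sup>+\<omega>\<in>B. indicator C \<omega> \<partial>pooled) = (\<integral>\<^sup>+\<omega>\<in>B. w \<omega> \<partial>pooled)" .
    qed auto
    have "emeasure (P r) (C \<inter> D) = (\<integral>\<^sup>+\<omega>\<in>D. w \<omega> \<partial>P r)" by (rule w'[OF r D])
    also have "\<dots> = (\<integral>\<^sup>+\<omega>. f \<omega> * (w \<omega> * indicator D \<omega>) \<partial>pooled)"
      by (intro nn_integral_P[OF r G f dens] borel_measurable_times_ennreal borel_measurable_indicator w D)
    also have "\<dots> = (\<integral>\<^sup>+\<omega>. (f \<omega> * indicator D \<omega>) * nn_cond_exp pooled G (indicator C) \<omega> \<partial>pooled)"
      using * by (intro nn_integral_cong_AE) (auto simp: mult_ac)
    also have "\<dots> = (\<integral>\<^sup>+\<omega>. (f \<omega> * indicator D \<omega>) * indicator C \<omega> \<partial>pooled)"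
      by (rule T.nn_cond_exp_intg) measurable
    also have "\<dots> = emeasure (density pooled f) (C \<inter> D)"
      by (simp add: emeasure_density indicator_inter_arith mult_ac)
    finally show "emeasure (P r) (C \<inter> D) = emeasure (density pooled f) (C \<inter> D)" .
  qed (simp_all add: sets_P[OF r])
  moreover have "sets (F \<squnion>\<^sub>\<sigma> G) \<subseteq> sets M" using subalgebra_join[OF F G] by (simp add: subalgebra_def)
  ultimately have "\<forall>C\<in>sets (F \<squnion>\<^sub>\<sigma> G). emeasure (P r) C = (\<integral>\<^sup>+\<omega>\<in>C. f \<omega> \<partial>pooled)"
    by (auto simp: emeasure_density subset_iff)
  then show "\<exists>f\<in>borel_measurable G. \<forall>C\<in>sets (F \<squnion>\<^sub>\<sigma> G). emeasure (P r) C = (\<integral>\<^sup>+\<omega>\<in>C. f \<omega> \<partial>pooled)"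
    using f by blast
qed

text \<open>
  A variable that is independent of \<open>F\<close> given \<open>G\<close> within each regime may be added to both
  \<open>\<sigma>\<close>-algebras.  The function \<open>\<alpha>\<close> may depend on the regime.  By symmetry of conditional independence
  the conditional probability of an event of \<open>F\<close> does not change when \<open>A\<close> is added to the condition,
  so it remains common to all regimes.
\<close>

lemma sufficient_join_cond_indep:
  assumes suff: "sufficient F G" and F: "subalgebra M F" and G: "subalgebra F G" and A: "subalgebra M A"
    and ci: "\<And>r D. r \<in> R \<Longrightarrow> D \<in> sets A \<Longrightarrow>
      \<exists>\<alpha>\<in>borel_measurable G. \<forall>C\<in>sets F. emeasure (P r) (D \<inter> C) = (\<integral>\<^sup>+\<omega>\<in>C. \<alpha> \<omega> \<partial>P r)"
  shows "sufficient (F \<squnion>\<^sub>\<sigma> A) (G \<squnion>\<^sub>\<sigma> A)"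
proof -
  have MG: "subalgebra M G" using F G by (auto simp: subalgebra_def)
  have sp: "space A = space F" "space A = space G" "space F = space M"
    using F G A by (auto simp: subalgebra_def)
  have MGA: "subalgebra M (G \<squnion>\<^sub>\<sigma> A)" by (rule subalgebra_join[OF MG A])
  have "sufficient (F \<squnion>\<^sub>\<sigma> (G \<squnion>\<^sub>\<sigma> A)) (G \<squnion>\<^sub>\<sigma> A)"
  proof (rule sufficient_joinI[OF F MGA], intro bexI ballI)
    fix C r B assume C[measurable]: "C \<in> sets F" and r: "r \<in> R" and B: "B \<in> sets (G \<squnion>\<^sub>\<sigma> A)"
    have "emeasure (P r) (C \<inter> B) = (\<integral>\<^sup>+\<omega>\<in>B. nn_cond_exp (P r) G (indicator C) \<omega> \<partial>P r)"
      using C B by (intro cond_indep_symmetric[OF finite_measure_P[OF r] subalgebra_P[OF r F] G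
            subalgebra_P[OF r A] ci[OF r]])
    also have "\<dots> = (\<integral>\<^sup>+\<omega>\<in>B. nn_cond_exp pooled G (indicator C) \<omega> \<partial>P r)"
      using sufficient_nn_cond_exp[OF suff F G r, of "indicator C"]
      by (intro nn_integral_cong_AE) auto
    finally show "emeasure (P r) (C \<inter> B) = (\<integral>\<^sup>+\<omega>\<in>B. nn_cond_exp pooled G (indicator C) \<omega> \<partial>P r)" .
  next
    fix C
    show "nn_cond_exp pooled G (indicator C) \<in> borel_measurable (G \<squnion>\<^sub>\<sigma> A)"
      using sp by (intro measurable_from_subalg[OF subalgebra_join_left]) auto
  qed
  then show ?thesis
  proof (rule sufficient_mono)
    show "subalgebra (G \<squnion>\<^sub>\<sigma> A) (G \<squnion>\<^sub>\<sigma> A)" by (simp add: subalgebra_def)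
    have "sets A \<subseteq> sets (G \<squnion>\<^sub>\<sigma> A)" using subalgebra_join_right[of A G] sp by (auto simp: subalgebra_def)
    then show "sets (F \<squnion>\<^sub>\<sigma> A) \<subseteq> sets (F \<squnion>\<^sub>\<sigma> (G \<squnion>\<^sub>\<sigma> A))"
      using sp sigma_sets_subseteq[OF Un_mono[OF order_refl], of "sets A" "sets (G \<squnion>\<^sub>\<sigma> A)" "space M" "sets F"]
      by (simp add: sets_join[of A F] sets_join[of "G \<squnion>\<^sub>\<sigma> A" F])
  qed
qed

end

section \<open>Sufficiency and extended conditional independence\<close>

text \<open>
  The Doob-Dynkin factorization lemma, needed because extended conditional independence asks for a
  function of the value of \<open>Z\<close>, while conditional expectations are functions on the sample space.
\<close>

lemma Doob_Dynkin_ennreal: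
  fixes f :: "'w \<Rightarrow> ennreal"
  assumes f: "f \<in> borel_measurable (vimage_algebra \<Omega> Z N)" and Z: "Z \<in> \<Omega> \<rightarrow> space N"
  shows "\<exists>g\<in>borel_measurable N. \<forall>\<omega>\<in>\<Omega>. f \<omega> = g (Z \<omega>)"
  using f
proof (induction rule: borel_measurable_induct)
  case (cong f g)
  then show ?case by auto
next
  case (set A)
  then obtain B where "B \<in> sets N" "A = Z -` B \<inter> \<Omega>" using sets_vimage_algebra2[OF Z] by auto
  then show ?case by (intro bexI[of _ "indicator B"]) (auto simp: indicator_def)
next
  case (mult u c)
  then obtain g where "g \<in> borel_measurable N" "\<forall>\<omega>\<in>\<Omega>. u \<omega> = g (Z \<omega>)" by blast
  then show ?case by (intro bexI[of _ "\<lambda>z. c * g z"]) auto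
next
  case (add u v)
  then obtain g h where "g \<in> borel_measurable N" "\<forall>\<omega>\<in>\<Omega>. u \<omega> = g (Z \<omega>)"
    "h \<in> borel_measurable N" "\<forall>\<omega>\<in>\<Omega>. v \<omega> = h (Z \<omega>)" by blast
  then show ?case by (intro bexI[of _ "\<lambda>z. h z + g z"]) auto
next
  case (seq W)
  then have "\<forall>i. \<exists>g. g \<in> borel_measurable N \<and> (\<forall>\<omega>\<in>\<Omega>. W i \<omega> = g (Z \<omega>))" by blast
  from choice[OF this] obtain g :: "nat \<Rightarrow> _" where
    g: "\<And>i. g i \<in> borel_measurable N" "\<And>i \<omega>. \<omega> \<in> \<Omega> \<Longrightarrow> W i \<omega> = g i (Z \<omega>)" by blast
  show ?case
  proof (intro bexI ballI)
    show "(SUP i. W i) \<omega> = (SUP i. g i (Z \<omega>))" if "\<omega> \<in> \<Omega>" for \<omega>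
      using g(2)[OF that] by (simp add: image_comp)
    show "(\<lambda>z. SUP i. g i z) \<in> borel_measurable N" using g(1) by measurable
  qed
qed

lemma sets_vimage_pair:
  assumes X: "X \<in> \<Omega> \<rightarrow> space MX" and Z: "Z \<in> \<Omega> \<rightarrow> space MZ"
  shows "sets (vimage_algebra \<Omega> (X \<otimes>\<^sub>v Z) (MX \<Otimes>\<^sub>M MZ)) =
    sets (vimage_algebra \<Omega> X MX \<squnion>\<^sub>\<sigma> vimage_algebra \<Omega> Z MZ)" (is "sets ?V = sets ?J")
proof
  have "X \<in> measurable ?J MX"
    by (rule measurable_from_subalg[OF subalgebra_join_left measurable_vimage_algebra1[OF X]]) simp
  moreover have "Z \<in> measurable ?J MZ"
    by (rule measurable_from_subalg[OF subalgebra_join_right measurable_vimage_algebra1[OF Z]]) simp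
  ultimately have "(X \<otimes>\<^sub>v Z) \<in> measurable ?J (MX \<Otimes>\<^sub>M MZ)" by (rule measurable_Pair)
  then show "sets ?V \<subseteq> sets ?J" by (intro sets_image_in_sets) auto
  have *: "(X \<otimes>\<^sub>v Z) \<in> measurable ?V (MX \<Otimes>\<^sub>M MZ)"
    using X Z by (intro measurable_vimage_algebra1) (auto simp: space_pair_measure)
  have "X \<in> measurable ?V MX" "Z \<in> measurable ?V MZ"
    using measurable_compose[OF * measurable_fst] measurable_compose[OF * measurable_snd] by auto
  then have "sets (vimage_algebra \<Omega> X MX) \<union> sets (vimage_algebra \<Omega> Z MZ) \<subseteq> sets ?V"
    by (intro Un_least sets_image_in_sets) auto
  then have "sigma_sets (space ?V) (sets (vimage_algebra \<Omega> X MX) \<union> sets (vimage_algebra \<Omega> Z MZ)) \<subseteq> sets ?V"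
    by (rule sets.sigma_sets_subset)
  then show "sets ?J \<subseteq> sets ?V" by (simp add: sets_join)
qed

lemma sets_vimage_family:
  assumes X: "\<And>j. j \<in> J \<Longrightarrow> X j \<in> \<Omega> \<rightarrow> space (N j)"
  shows "sets (vimage_algebra \<Omega> (family X J) (PiM J N)) =
    sigma_sets \<Omega> (\<Union>j\<in>J. sets (vimage_algebra \<Omega> (X j) (N j)))" (is "sets ?V = sigma_sets \<Omega> ?E")
proof
  have E: "?E \<subseteq> Pow \<Omega>" using sets.space_closed[of "vimage_algebra \<Omega> _ _"] by fastforce
  have "X j \<in> measurable (sigma \<Omega> ?E) (N j)" if "j \<in> J" for j
  proof (rule measurable_from_subalg[OF _ measurable_vimage_algebra1])
    show "subalgebra (sigma \<Omega> ?E) (vimage_algebra \<Omega> (X j) (N j))"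
      using that E by (auto simp: subalgebra_def)
  qed (use X that in auto)
  then have "family X J \<in> measurable (sigma \<Omega> ?E) (PiM J N)"
    unfolding family_def by (intro measurable_restrict) auto
  then have "sets ?V \<subseteq> sets (sigma \<Omega> ?E)" using E by (intro sets_image_in_sets) auto
  then show "sets ?V \<subseteq> sigma_sets \<Omega> ?E" using E by simp
  have *: "family X J \<in> measurable ?V (PiM J N)"
    using X by (intro measurable_vimage_algebra1) (fastforce simp: space_PiM family_def)
  have "X j \<in> measurable ?V (N j)" if "j \<in> J" for j
    using measurable_compose[OF * measurable_component_singleton[OF that]] that by (simp add: family_def)
  then have "?E \<subseteq> sets ?V" by (intro UN_least sets_image_in_sets) auto
  then have "sigma_sets (space ?V) ?E \<subseteq> sets ?V" by (rule sets.sigma_sets_subset)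
  then show "sigma_sets \<Omega> ?E \<subseteq> sets ?V" by simp
qed

lemma eci_subset:
  assumes eci: "eci R P MX X MY Y MZ Z" and sub: "R' \<subseteq> R"
  shows "eci R' P MX X MY Y MZ Z"
  unfolding eci_def
proof (intro allI impI)
  fix h assume "bounded_measurable MX h"
  with eci obtain w where "\<forall>r\<in>R. w r \<in> borel_measurable MZ"
    "\<forall>r\<in>R. AE \<omega> in P r. cond_exp_rv (P r) (MY \<Otimes>\<^sub>M MZ) (Y \<otimes>\<^sub>v Z) (\<lambda>\<omega>'. h (X \<omega>')) \<omega> = w r (Z \<omega>)"
    unfolding eci_def by blast
  with sub show "\<exists>w. (\<forall>r\<in>R'. w r \<in> borel_measurable MZ) \<and>
      (\<forall>r\<in>R'. AE \<omega> in P r. cond_exp_rv (P r) (MY \<Otimes>\<^sub>M MZ) (Y \<otimes>\<^sub>v Z) (\<lambda>\<omega>'. h (X \<omega>')) \<omega> = w r (Z \<omega>))"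
    by (intro exI[of _ w]) (simp add: subset_iff)
qed

context regimes
begin

lemma subalgebra_vimage: "X \<in> M \<rightarrow>\<^sub>M N \<Longrightarrow> subalgebra M (vimage_algebra (space M) X N)"
  by (simp add: subalgebra_def sets_image_in_sets)

lemma eci_regime_imp_sufficient:
  assumes X: "X \<in> M \<rightarrow>\<^sub>M MX" and Z: "Z \<in> M \<rightarrow>\<^sub>M MZ" and eci: "eci_regime R P MX X MZ Z"
  shows "sufficient (vimage_algebra (space M) X MX \<squnion>\<^sub>\<sigma> vimage_algebra (space M) Z MZ)
    (vimage_algebra (space M) Z MZ)" (is "sufficient (?F \<squnion>\<^sub>\<sigma> ?G) ?G")
proof (rule sufficient_joinI[OF subalgebra_vimage[OF X] subalgebra_vimage[OF Z]])
  fix C assume "C \<in> sets ?F"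
  then obtain B where B: "B \<in> sets MX" "C = X -` B \<inter> space M"
    using sets_vimage_algebra2[of X "space M" MX] measurable_space[OF X] by auto
  have "bounded_measurable MX (indicator B)"
    unfolding bounded_measurable_def using B(1) by (auto simp: bounded_iff intro!: exI[of _ 1])
  then obtain w :: "_ \<Rightarrow> real" where w[measurable]: "w \<in> borel_measurable MZ"
    and w': "\<And>r. r \<in> R \<Longrightarrow> AE \<omega> in P r. cond_exp_rv (P r) MZ Z (\<lambda>\<omega>'. indicator B (X \<omega>')) \<omega> = w (Z \<omega>)"
    using eci unfolding eci_regime_def by blast
  have "Z \<in> ?G \<rightarrow>\<^sub>M MZ" using measurable_space[OF Z] by (intro measurable_vimage_algebra1) auto
  then have "(\<lambda>\<omega>. ennreal (w (Z \<omega>))) \<in> borel_measurable ?G" by measurable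
  moreover have "emeasure (P r) (C \<inter> D) = (\<integral>\<^sup>+\<omega>\<in>D. ennreal (w (Z \<omega>)) \<partial>P r)"
    if r: "r \<in> R" and D: "D \<in> sets ?G" for r D
    using emeasure_Int_eq_cond_exp[OF finite_measure_P[OF r] subalgebra_P[OF r subalgebra_vimage[OF Z]] _ B(1)
        _ D, of X "\<lambda>\<omega>. w (Z \<omega>)"] w'[OF r] X B(2) measurable_cong_sets[OF sets_P[OF r] refl, of MX]
    by (simp add: cond_exp_rv_def space_P[OF r])
  ultimately show "\<exists>w\<in>borel_measurable ?G. \<forall>r\<in>R. \<forall>B\<in>sets ?G.
      emeasure (P r) (C \<inter> B) = (\<integral>\<^sup>+\<omega>\<in>B. w \<omega> \<partial>P r)"
    by (intro bexI[of _ "\<lambda>\<omega>. ennreal (w (Z \<omega>))"]) auto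
qed

lemma sufficient_imp_eci_regime:
  assumes X: "X \<in> M \<rightarrow>\<^sub>M MX" and Z: "Z \<in> M \<rightarrow>\<^sub>M MZ"
    and suff: "sufficient F (vimage_algebra (space M) Z MZ)" (is "sufficient F ?G")
    and F: "subalgebra M F" and FX: "X \<in> F \<rightarrow>\<^sub>M MX" and FZ: "Z \<in> F \<rightarrow>\<^sub>M MZ"
  shows "eci_regime R P MX X MZ Z"
  unfolding eci_regime_def
proof (intro allI impI)
  fix h assume "bounded_measurable MX h"
  then have h[measurable]: "h \<in> borel_measurable MX" by (simp add: bounded_measurable_def)
  have Z': "Z \<in> space M \<rightarrow> space MZ" using measurable_space[OF Z] by auto
  have FG: "subalgebra F ?G"
    using F sets_image_in_sets[OF _ FZ, of "space M"] by (simp add: subalgebra_def)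
  note [measurable] = FX
  have version: "\<exists>g\<in>borel_measurable MZ. \<forall>r\<in>R. AE \<omega> in P r.
      nn_cond_exp (P r) ?G (\<lambda>\<omega>. ennreal (k (X \<omega>))) \<omega> = g (Z \<omega>)"
    if k[measurable]: "k \<in> borel_measurable MX" for k
  proof -
    have "nn_cond_exp pooled ?G (\<lambda>\<omega>. ennreal (k (X \<omega>))) \<in> borel_measurable ?G" by measurable
    from Doob_Dynkin_ennreal[OF this Z'] obtain g where g: "g \<in> borel_measurable MZ"
      "\<forall>\<omega>\<in>space M. nn_cond_exp pooled ?G (\<lambda>\<omega>. ennreal (k (X \<omega>))) \<omega> = g (Z \<omega>)" by blast
    show ?thesis
    proof (intro bexI[OF _ g(1)] ballI)
      fix r assume r: "r \<in> R"
      have "AE \<omega> in P r. nn_cond_exp pooled ?G (\<lambda>\<omega>. ennreal (k (X \<omega>))) \<omega>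
          = nn_cond_exp (P r) ?G (\<lambda>\<omega>. ennreal (k (X \<omega>))) \<omega>"
        by (rule sufficient_nn_cond_exp[OF suff F FG r]) measurable
      then show "AE \<omega> in P r. nn_cond_exp (P r) ?G (\<lambda>\<omega>. ennreal (k (X \<omega>))) \<omega> = g (Z \<omega>)"
        using AE_space by eventually_elim (use g(2) in \<open>simp add: space_P[OF r]\<close>)
    qed
  qed
  \<comment> \<open>A real conditional expectation is the difference of those of the positive and negative parts.\<close>
  obtain g where g[measurable]: "g \<in> borel_measurable MZ"
    and g': "\<And>r. r \<in> R \<Longrightarrow> AE \<omega> in P r. nn_cond_exp (P r) ?G (\<lambda>\<omega>. ennreal (h (X \<omega>))) \<omega> = g (Z \<omega>)"
    using version[of h] by auto
  obtain g0 where g0[measurable]: "g0 \<in> borel_measurable MZ"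
    and g0': "\<And>r. r \<in> R \<Longrightarrow> AE \<omega> in P r. nn_cond_exp (P r) ?G (\<lambda>\<omega>. ennreal (- h (X \<omega>))) \<omega> = g0 (Z \<omega>)"
    using version[of "\<lambda>x. - h x"] by auto
  show "\<exists>w. w \<in> borel_measurable MZ \<and>
      (\<forall>r\<in>R. AE \<omega> in P r. cond_exp_rv (P r) MZ Z (\<lambda>\<omega>'. h (X \<omega>')) \<omega> = w (Z \<omega>))"
  proof (intro exI[of _ "\<lambda>z. enn2real (g z) - enn2real (g0 z)"] conjI ballI)
    show "(\<lambda>z. enn2real (g z) - enn2real (g0 z)) \<in> borel_measurable MZ" by measurable
    show "AE \<omega> in P r. cond_exp_rv (P r) MZ Z (\<lambda>\<omega>'. h (X \<omega>')) \<omega> = enn2real (g (Z \<omega>)) - enn2real (g0 (Z \<omega>))"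
      if r: "r \<in> R" for r
      using g'[OF r] g0'[OF r] unfolding cond_exp_rv_def real_cond_exp_def space_P[OF r]
      by eventually_elim simp
  qed
qed

text \<open>
  The function \<open>w\<close> of extended conditional independence may vary with the regime, so all that
  remains is ordinary conditional independence of \<open>X\<close> and \<open>Y\<close> given \<open>Z\<close> in each regime.  It is stated
  as the condition \<open>ci\<close> of the preceding lemmas, with \<open>F\<close> the \<open>\<sigma>\<close>-algebra of \<open>(Y, Z)\<close>.
\<close>

lemma eci_imp_cond_indep:
  assumes X: "X \<in> M \<rightarrow>\<^sub>M MX" and Y: "Y \<in> M \<rightarrow>\<^sub>M MY" and Z: "Z \<in> M \<rightarrow>\<^sub>M MZ"
    and eci: "eci R P MX X MY Y MZ Z" and r: "r \<in> R"
    and D: "D \<in> sets (vimage_algebra (space M) X MX)"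
  shows "\<exists>\<alpha>\<in>borel_measurable (vimage_algebra (space M) Z MZ).
    \<forall>C\<in>sets (vimage_algebra (space M) (Y \<otimes>\<^sub>v Z) (MY \<Otimes>\<^sub>M MZ)).
      emeasure (P r) (D \<inter> C) = (\<integral>\<^sup>+\<omega>\<in>C. \<alpha> \<omega> \<partial>P r)"
proof -
  obtain B where B: "B \<in> sets MX" "D = X -` B \<inter> space M"
    using D sets_vimage_algebra2[of X "space M" MX] measurable_space[OF X] by auto
  have "bounded_measurable MX (indicator B)"
    unfolding bounded_measurable_def using B(1) by (auto simp: bounded_iff intro!: exI[of _ 1])
  then obtain w :: "_ \<Rightarrow> _ \<Rightarrow> real" where "\<forall>r\<in>R. w r \<in> borel_measurable MZ"
    and "\<forall>r\<in>R. AE \<omega> in P r.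
      cond_exp_rv (P r) (MY \<Otimes>\<^sub>M MZ) (Y \<otimes>\<^sub>v Z) (\<lambda>\<omega>'. indicator B (X \<omega>')) \<omega> = w r (Z \<omega>)"
    using eci unfolding eci_def by blast
  then have w[measurable]: "w r \<in> borel_measurable MZ"
    and w': "AE \<omega> in P r.
      cond_exp_rv (P r) (MY \<Otimes>\<^sub>M MZ) (Y \<otimes>\<^sub>v Z) (\<lambda>\<omega>'. indicator B (X \<omega>')) \<omega> = w r (Z \<omega>)" using r by auto
  have "Z \<in> vimage_algebra (space M) Z MZ \<rightarrow>\<^sub>M MZ"
    using measurable_space[OF Z] by (intro measurable_vimage_algebra1) auto
  then have "(\<lambda>\<omega>. ennreal (w r (Z \<omega>))) \<in> borel_measurable (vimage_algebra (space M) Z MZ)" by measurable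
  moreover have "emeasure (P r) (D \<inter> C) = (\<integral>\<^sup>+\<omega>\<in>C. ennreal (w r (Z \<omega>)) \<partial>P r)"
    if C: "C \<in> sets (vimage_algebra (space M) (Y \<otimes>\<^sub>v Z) (MY \<Otimes>\<^sub>M MZ))" for C
    using emeasure_Int_eq_cond_exp[OF finite_measure_P[OF r]
        subalgebra_P[OF r subalgebra_vimage[OF measurable_Pair[OF Y Z]]] _ B(1) _ C, of X "\<lambda>\<omega>. w r (Z \<omega>)"]
      w' X B(2) measurable_cong_sets[OF sets_P[OF r] refl, of MX]
    by (simp add: cond_exp_rv_def space_P[OF r])
  ultimately show ?thesis by (intro bexI[of _ "\<lambda>\<omega>. ennreal (w r (Z \<omega>))"]) auto
qed

end

section \<open>Sigma-algebras of histories\<close>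

definition component_events :: "'w set \<Rightarrow> (nat \<Rightarrow> 'w \<Rightarrow> 'x) \<Rightarrow> (nat \<Rightarrow> 'x measure) \<Rightarrow> nat set \<Rightarrow> 'w set set" where
  "component_events \<Omega> X N J = (\<Union>j\<in>J. sets (vimage_algebra \<Omega> (X j) (N j)))"

lemma component_events_subset: "component_events \<Omega> X N J \<subseteq> Pow \<Omega>"
  using sets.space_closed[of "vimage_algebra \<Omega> _ _"] by (fastforce simp: component_events_def)

text \<open>
  One \<open>\<sigma>\<close>-algebra for all groupings and orderings of the variables: joining histories is taking unions
  of the index sets, so that tuples never have to be rearranged by measurable maps.
\<close>

definition history ::
  "'w set \<Rightarrow> (nat \<Rightarrow> 'l measure) \<Rightarrow> (nat \<Rightarrow> 'w \<Rightarrow> 'l) \<Rightarrow> (nat \<Rightarrow> 'u measure) \<Rightarrow> (nat \<Rightarrow> 'w \<Rightarrow> 'u)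
    \<Rightarrow> (nat \<Rightarrow> 'a measure) \<Rightarrow> (nat \<Rightarrow> 'w \<Rightarrow> 'a) \<Rightarrow> nat set \<Rightarrow> nat set \<Rightarrow> nat set \<Rightarrow> 'w measure" where
  "history \<Omega> EL L EU U EA A I J K =
    sigma \<Omega> (component_events \<Omega> L EL I \<union> component_events \<Omega> U EU J \<union> component_events \<Omega> A EA K)"

lemma space_history [simp]: "space (history \<Omega> EL L EU U EA A I J K) = \<Omega>"
  by (simp add: history_def space_measure_of_conv)

lemma sets_history:
  "sets (history \<Omega> EL L EU U EA A I J K) =
    sigma_sets \<Omega> (component_events \<Omega> L EL I \<union> component_events \<Omega> U EU J \<union> component_events \<Omega> A EA K)"
  unfolding history_def by (intro sets_measure_of) (simp add: component_events_subset)

lemma sets_history_mono: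
  assumes "I \<subseteq> I'" "J \<subseteq> J'" "K \<subseteq> K'"
  shows "sets (history \<Omega> EL L EU U EA A I J K) \<subseteq> sets (history \<Omega> EL L EU U EA A I' J' K')"
  unfolding sets_history component_events_def using assms by (intro sigma_sets_subseteq) blast

lemma history_join:
  "sets (history \<Omega> EL L EU U EA A I J K \<squnion>\<^sub>\<sigma> history \<Omega> EL L EU U EA A I' J' K') =
    sets (history \<Omega> EL L EU U EA A (I \<union> I') (J \<union> J') (K \<union> K'))"
proof -
  have "component_events \<Omega> L EL I \<union> component_events \<Omega> U EU J \<union> component_events \<Omega> A EA K \<subseteq> Pow \<Omega>" for I J K
    by (simp add: component_events_subset)
  moreover have "component_events \<Omega> X N (S \<union> T) = component_events \<Omega> X N S \<union> component_events \<Omega> X N T"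
    for X :: "nat \<Rightarrow> 'a \<Rightarrow> 'x" and N S T by (simp add: component_events_def)
  ultimately show ?thesis
    by (simp add: sets_join sets_history sigma_sets_Un_sigma_sets component_events_def UN_Un Un_ac)
qed

lemma sets_vimage_family_component_events:
  assumes "\<And>j. j \<in> J \<Longrightarrow> X j \<in> \<Omega> \<rightarrow> space (N j)"
  shows "sets (vimage_algebra \<Omega> (family X J) (PiM J N)) = sigma_sets \<Omega> (component_events \<Omega> X N J)"
  unfolding component_events_def by (rule sets_vimage_family[OF assms])

lemma sets_vimage_component_events: "sets (vimage_algebra \<Omega> (X i) (N i)) = sigma_sets \<Omega> (component_events \<Omega> X N {i})"
  using sets.sigma_sets_eq[of "vimage_algebra \<Omega> (X i) (N i)"] by (simp add: component_events_def)

lemma component_events_empty [simp]: "component_events \<Omega> X N {} = {}"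
  by (simp add: component_events_def)

lemma sets_vimage_pair_history:
  assumes "X \<in> M \<rightarrow>\<^sub>M MX" "Z \<in> M \<rightarrow>\<^sub>M MZ"
    and "sets (vimage_algebra (space M) X MX) = sets (history (space M) EL L EU U EA A I J K)"
    and "sets (vimage_algebra (space M) Z MZ) = sets (history (space M) EL L EU U EA A I' J' K')"
  shows "sets (vimage_algebra (space M) (X \<otimes>\<^sub>v Z) (MX \<Otimes>\<^sub>M MZ)) =
    sets (history (space M) EL L EU U EA A (I \<union> I') (J \<union> J') (K \<union> K'))"
  using sets_vimage_pair[of X "space M" MX Z MZ] measurable_space[OF assms(1)] measurable_space[OF assms(2)]
    join_cong[OF assms(3,4)] by (simp add: history_join Pi_iff)

section \<open>From extended to simple stability\<close>

theorem theorem5p1: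
  fixes M :: "'w measure" and n :: nat
    and EL :: "nat \<Rightarrow> 'l measure" and L :: "nat \<Rightarrow> 'w \<Rightarrow> 'l"
    and EU :: "nat \<Rightarrow> 'u measure" and U :: "nat \<Rightarrow> 'w \<Rightarrow> 'u"
    and EA :: "nat \<Rightarrow> 'a measure" and A :: "nat \<Rightarrow> 'w \<Rightarrow> 'a"
    and obs :: 'r and S :: "'r set" and P :: "'r \<Rightarrow> 'w measure"
    and \<kappa> :: "'r \<Rightarrow> nat \<Rightarrow> (nat \<Rightarrow> 'l) \<times> (nat \<Rightarrow> 'a) \<Rightarrow> 'a measure"
  assumes rv_L: "\<And>i. i \<in> {1..n+1} \<Longrightarrow> L i \<in> M \<rightarrow>\<^sub>M EL i"
    and rv_U: "\<And>i. i \<in> {1..n} \<Longrightarrow> U i \<in> M \<rightarrow>\<^sub>M EU i"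
    and rv_A: "\<And>i. i \<in> {1..n} \<Longrightarrow> A i \<in> M \<rightarrow>\<^sub>M EA i"
    and regime_prob: "\<And>r. r \<in> insert obs S \<Longrightarrow> prob_space (P r)"
    and regime_sets: "\<And>r. r \<in> insert obs S \<Longrightarrow> sets (P r) = sets M"
    and control: "\<And>s. s \<in> S \<Longrightarrow> control_strategy n EL L EU U EA A (P s) (\<kappa> s)"
    and extended_stability:
      "\<And>s i. s \<in> S \<Longrightarrow> i \<in> {1..n+1} \<Longrightarrow>
        eci_regime {obs, s} P
          (EL i \<Otimes>\<^sub>M PiM ({i} \<inter> {1..n}) EU) (L i \<otimes>\<^sub>v family U ({i} \<inter> {1..n}))
          (PiM {1..<i} EL \<Otimes>\<^sub>M PiM {1..<i} EU \<Otimes>\<^sub>M PiM {1..<i} EA)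
          (family L {1..<i} \<otimes>\<^sub>v family U {1..<i} \<otimes>\<^sub>v family A {1..<i})"
    and sequential_randomization:
      "\<And>i. i \<in> {1..n} \<Longrightarrow>
        eci (insert obs S) P
          (EA i) (A i)
          (PiM {1..i} EU) (family U {1..i})
          (PiM {1..i} EL \<Otimes>\<^sub>M PiM {1..<i} EA) (family L {1..i} \<otimes>\<^sub>v family A {1..<i})"
  shows "\<forall>s\<in>S. \<forall>i\<in>{1..n+1}.
        eci_regime {obs, s} P
          (EL i) (L i)
          (PiM {1..<i} EL \<Otimes>\<^sub>M PiM {1..<i} EA) (family L {1..<i} \<otimes>\<^sub>v family A {1..<i})"
proof (intro ballI)
  fix s i assume s: "s \<in> S" and i: "i \<in> {1..n+1}"
  have prob_s: "prob_space (P r)" and sets_s: "sets (P r) = sets M" if "r \<in> {obs, s}" for r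
    using that s regime_prob[of r] regime_sets[of r] by blast+
  interpret regimes M "{obs, s}" P
    by (rule regimes.intro[OF _ _ prob_s sets_s]) simp_all
  let ?H = "history (space M) EL L EU U EA A"
  let ?V = "vimage_algebra (space M)"
  have fam_L: "family L I \<in> M \<rightarrow>\<^sub>M PiM I EL" if "I \<subseteq> {1..n+1}" for I
    unfolding family_def using that by (intro measurable_restrict rv_L) auto
  have fam_U: "family U J \<in> M \<rightarrow>\<^sub>M PiM J EU" if "J \<subseteq> {1..n}" for J
    unfolding family_def using that by (intro measurable_restrict rv_U) auto
  have fam_A: "family A K \<in> M \<rightarrow>\<^sub>M PiM K EA" if "K \<subseteq> {1..n}" for K
    unfolding family_def using that by (intro measurable_restrict rv_A) auto
  have V_L: "sets (?V (family L I) (PiM I EL)) = sets (?H I {} {})" if "I \<subseteq> {1..n+1}" for I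
    using that measurable_space[OF rv_L] by (subst sets_vimage_family_component_events) (auto simp: sets_history)
  have V_U: "sets (?V (family U J) (PiM J EU)) = sets (?H {} J {})" if "J \<subseteq> {1..n}" for J
    using that measurable_space[OF rv_U] by (subst sets_vimage_family_component_events) (auto simp: sets_history)
  have V_A: "sets (?V (family A K) (PiM K EA)) = sets (?H {} {} K)" if "K \<subseteq> {1..n}" for K
    using that measurable_space[OF rv_A] by (subst sets_vimage_family_component_events) (auto simp: sets_history)
  have V_L1: "sets (?V (L i) (EL i)) = sets (?H {i} {} {})" for i
    by (simp add: sets_vimage_component_events sets_history)
  have V_A1: "sets (?V (A i) (EA i)) = sets (?H {} {} {i})" for i
    by (simp add: sets_vimage_component_events sets_history)
  note V_pair = sets_vimage_pair_history[of _ M]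
  have V_LA: "sets (?V (family L I \<otimes>\<^sub>v family A K) (PiM I EL \<Otimes>\<^sub>M PiM K EA)) = sets (?H I {} K)"
    if "I \<subseteq> {1..n+1}" "K \<subseteq> {1..n}" for I K
    using V_pair[OF fam_L fam_A V_L V_A] that by simp
  have sub: "subalgebra (?H I' J' K') (?H I J K)" if "I \<subseteq> I'" "J \<subseteq> J'" "K \<subseteq> K'" for I J K I' J' K'
    using sets_history_mono[OF that] by (simp add: subalgebra_def)
  have sub_M: "subalgebra M (?H I J K)" if "I \<subseteq> {1..n+1}" "J \<subseteq> {1..n}" "K \<subseteq> {1..n}" for I J K
  proof -
    have "sets (?V (family L I \<otimes>\<^sub>v family U J \<otimes>\<^sub>v family A K) (PiM I EL \<Otimes>\<^sub>M PiM J EU \<Otimes>\<^sub>M PiM K EA))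
        = sets (?H I J K)"
      using V_pair[OF fam_L _ V_L V_pair[OF fam_U fam_A V_U V_A], of I J K]
        measurable_Pair[OF fam_U fam_A] that by simp
    then show ?thesis
      using subalgebra_vimage[OF measurable_Pair[OF fam_L measurable_Pair[OF fam_U fam_A]], of I J K] that
      by (simp add: subalgebra_def)
  qed
  \<comment> \<open>One stage of extended stability, combined with the invariant for the past by transitivity.\<close>
  have full: "sufficient (?H {1..i} ({1..<i} \<union> ({i} \<inter> {1..n})) {1..<i}) (?H {1..<i} {} {1..<i})"
    if i: "i \<in> {1..n+1}" and past: "sufficient (?H {1..<i} {1..<i} {1..<i}) (?H {1..<i} {} {1..<i})" for i
  proof (rule sufficient_trans[OF _ past])
    have sub_i: "{1..<i} \<subseteq> {1..n+1}" "{1..<i} \<subseteq> {1..n}" "{i} \<inter> {1..n} \<subseteq> {1..n}" "insert i {1..<i} = {1..i}"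
      using i by auto
    let ?X = "L i \<otimes>\<^sub>v family U ({i} \<inter> {1..n})" and ?MX = "EL i \<Otimes>\<^sub>M PiM ({i} \<inter> {1..n}) EU"
    let ?Z = "family L {1..<i} \<otimes>\<^sub>v family U {1..<i} \<otimes>\<^sub>v family A {1..<i}"
    let ?MZ = "PiM {1..<i} EL \<Otimes>\<^sub>M PiM {1..<i} EU \<Otimes>\<^sub>M PiM {1..<i} EA"
    have X: "?X \<in> M \<rightarrow>\<^sub>M ?MX" and Z: "?Z \<in> M \<rightarrow>\<^sub>M ?MZ"
      using rv_L[OF i] fam_L fam_U fam_A sub_i by (auto intro!: measurable_Pair)
    have VX: "sets (?V ?X ?MX) = sets (?H {i} ({i} \<inter> {1..n}) {})"
      using V_pair[OF rv_L[OF i] fam_U V_L1 V_U] sub_i by simp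
    have VZ: "sets (?V ?Z ?MZ) = sets (?H {1..<i} {1..<i} {1..<i})"
      using V_pair[OF fam_L _ V_L V_pair[OF fam_U fam_A V_U V_A], of "{1..<i}" "{1..<i}" "{1..<i}"]
        measurable_Pair[OF fam_U fam_A] sub_i by simp
    have suff: "sufficient (?V ?X ?MX \<squnion>\<^sub>\<sigma> ?V ?Z ?MZ) (?V ?Z ?MZ)"
      by (rule eci_regime_imp_sufficient[OF X Z extended_stability[OF s i]])
    have "sets (?V ?X ?MX \<squnion>\<^sub>\<sigma> ?V ?Z ?MZ) = sets (?H {1..i} ({1..<i} \<union> ({i} \<inter> {1..n})) {1..<i})"
      unfolding join_cong[OF VX VZ] history_join using sub_i(4) by (simp add: Un_commute)
    with suff VZ show "sufficient (?H {1..i} ({1..<i} \<union> ({i} \<inter> {1..n})) {1..<i}) (?H {1..<i} {1..<i} {1..<i})"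
      by (elim sufficient_mono) (auto simp: subalgebra_def)
    show "subalgebra M (?H {1..i} ({1..<i} \<union> ({i} \<inter> {1..n})) {1..<i})"
      using i by (intro sub_M) auto
  qed (auto intro!: sub)
  \<comment> \<open>The invariant: the observable past is sufficient for the full past.\<close>
  have past: "sufficient (?H {1..<Suc k} {1..<Suc k} {1..<Suc k}) (?H {1..<Suc k} {} {1..<Suc k})"
    if "k \<le> n" for k
    using that
  proof (induction k)
    case 0
    show ?case by (auto intro!: sufficient_refl sub_M)
  next
    case (Suc k)
    let ?i = "Suc k"
    have i: "?i \<in> {1..n}" "?i \<in> {1..n+1}" using Suc.prems by auto
    have ivl: "{1..<?i} \<union> {?i} = {1..?i}" "{1..<?i} \<union> ({?i} \<inter> {1..n}) = {1..?i}" "{1..<Suc ?i} = {1..?i}"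
      "{1..?i} \<subseteq> {1..n+1}" "{1..?i} \<subseteq> {1..n}" "{1..<?i} \<subseteq> {1..n}" "{1..<?i} \<subseteq> {1..?i}"
      using i by auto
    have "sufficient (?H {1..?i} {1..?i} {1..<?i}) (?H {1..<?i} {} {1..<?i})"
      using full[OF i(2)] Suc ivl(2) by simp
    \<comment> \<open>The new observation moves to the conditioning side.\<close>
    then have suff: "sufficient (?H {1..?i} {1..?i} {1..<?i}) (?H {1..?i} {} {1..<?i})"
      by (rule sufficient_mono) (auto intro!: sub)
    let ?Z = "family L {1..?i} \<otimes>\<^sub>v family A {1..<?i}" and ?MZ = "PiM {1..?i} EL \<Otimes>\<^sub>M PiM {1..<?i} EA"
    let ?MY = "PiM {1..?i} EU"
    have Y: "family U {1..?i} \<in> M \<rightarrow>\<^sub>M ?MY" and Z: "?Z \<in> M \<rightarrow>\<^sub>M ?MZ"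
      using fam_U fam_L fam_A ivl by (auto intro!: measurable_Pair)
    have VZ: "sets (?V ?Z ?MZ) = sets (?H {1..?i} {} {1..<?i})"
      using V_LA ivl by blast
    have VYZ: "sets (?V (family U {1..?i} \<otimes>\<^sub>v ?Z) (?MY \<Otimes>\<^sub>M ?MZ)) = sets (?H {1..?i} {1..?i} {1..<?i})"
      using V_pair[OF Y Z V_U VZ] ivl by simp
    \<comment> \<open>Sequential randomization lets the action join both sides.\<close>
    have "eci {obs, s} P (EA ?i) (A ?i) ?MY (family U {1..?i}) ?MZ ?Z"
      by (rule eci_subset[OF sequential_randomization[OF i(1)]]) (use s in auto)
    from eci_imp_cond_indep[OF rv_A[OF i(1)] Y Z this]
    have "sufficient (?H {1..?i} {1..?i} {1..<?i} \<squnion>\<^sub>\<sigma> ?H {} {} {?i}) (?H {1..?i} {} {1..<?i} \<squnion>\<^sub>\<sigma> ?H {} {} {?i})"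
      unfolding VYZ V_A1 measurable_cong_sets[OF VZ refl]
      using i ivl by (intro sufficient_join_cond_indep[OF suff] sub_M sub) auto
    then show ?case
      unfolding ivl(3)
      by (rule sufficient_mono) (simp_all only: subalgebra_def history_join ivl(1) Un_empty_right
        space_join space_history order_refl simp_thms)
  qed
  let ?Z = "family L {1..<i} \<otimes>\<^sub>v family A {1..<i}" and ?MZ = "PiM {1..<i} EL \<Otimes>\<^sub>M PiM {1..<i} EA"
  let ?F = "?H {1..i} ({1..<i} \<union> ({i} \<inter> {1..n})) {1..<i}"
  obtain k where k: "i = Suc k" "k \<le> n" using i by (cases i) auto
  have sub_i: "{1..<i} \<subseteq> {1..n+1}" "{1..<i} \<subseteq> {1..n}" using i by auto
  have Z: "?Z \<in> M \<rightarrow>\<^sub>M ?MZ" using fam_L fam_A sub_i by (auto intro!: measurable_Pair)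
  have VZ: "sets (?V ?Z ?MZ) = sets (?H {1..<i} {} {1..<i})" using V_LA sub_i by blast
  show "eci_regime {obs, s} P (EL i) (L i) ?MZ ?Z"
  proof (rule sufficient_imp_eci_regime[OF rv_L[OF i] Z])
    show "sufficient ?F (?V ?Z ?MZ)"
      by (rule sufficient_mono[OF full[OF i past[OF k(2), folded k(1)]]])
        (simp_all only: subalgebra_def VZ space_vimage_algebra space_history order_refl simp_thms)
    show "subalgebra M ?F" using i by (intro sub_M) auto
    have "subalgebra ?F (?V ?Z ?MZ)"
      unfolding subalgebra_def VZ by (intro conjI sets_history_mono) auto
    then show "?Z \<in> ?F \<rightarrow>\<^sub>M ?MZ"
      by (rule measurable_from_subalg) (use measurable_space[OF Z] in \<open>auto intro!: measurable_vimage_algebra1\<close>)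
    have "subalgebra ?F (?V (L i) (EL i))"
      unfolding subalgebra_def V_L1 using i by (intro conjI sets_history_mono) auto
    then show "L i \<in> ?F \<rightarrow>\<^sub>M EL i"
      by (rule measurable_from_subalg) (use measurable_space[OF rv_L[OF i]] in \<open>auto intro!: measurable_vimage_algebra1\<close>)
  qed
qed

end
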